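(* Algorithm RVC (described in the context) guarantees rendezvous at cost $O(P)$ for any two agents with coherent compasses, in any terrain. Here $P$ is the perimeter of the terrain.
   Context: A terrain is a planar set $\mathcal{P}_0\setminus(\mathcal{P}_1\cup\dots\cup\mathcal{P}_k)$, where $\mathcal{P}_0$ is a closed polygon and $\mathcal{P}_1,\dots,\mathcal{P}_k$ (the obstacles, possibly none) are disjoint open polygons included in $\mathcal{P}_0$; the boundary of the terrain belongs to it. The perimeter $P$ of the terrain is the sum of the perimeters of $\mathcal{P}_0,\mathcal{P}_1,\dots,\mathcal{P}_k$. Agents: two agents, modeled as points, start at different points of the terrain chosen by the adversary. The terrain is a priori unknown to them (no map). Each has a unit of length and a compass (a direction called North); both use the same clockwise orientation. Compasses are coherent if both agents have the same North. An agent knows whether it is at an interior or a boundary point, and in the latter case the slope(s) of the boundary there; it cannot sense the terrain or the other agent in any vicinity of its location. The agents may be anonymous, i.e., they execute identical algorithms. Routes: an agent constructs a finite polygonal path in the terrain (its route) in steps. In a step starting at a point, the agent chooses a direction (according to its compass) and a distance; if the segment of this length in this direction does not intersect the boundary, the step ends at the end of this segment, otherwise it ends at the closest boundary point in this direction. If the starting point of the step is on a segment of the boundary, the agent may alternatively follow this segment in either direction until its end or for a given distance. Walks: let the route be $(S_1,\dots,S_k)$ with $S_i=[a_i,a_{i+1}]$. The adversary chooses reals $0=t_1<t_2<\dots<t_{k+1}$ and continuous functions $f_i:[t_i,t_{i+1}]\to[a_i,a_{i+1}]$ with $f_i(t_i)=a_i$, $f_i(t_{i+1})=a_{i+1}$;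 the walk is $f(t)=f_i(t)$ for $t\in[t_i,t_{i+1}]$, and the agent is inert after $t_{k+1}$. Agents with walks $f_1,f_2$ meet (rendezvous) at time $t$ if $f_1(t)=f_2(t)$. Rendezvous is guaranteed if the agents meet at some time regardless of the walks chosen by the adversary. The trajectory of an agent is the sequence of segments of its route until rendezvous (the last one possibly being a portion of a route segment). The cost of an algorithm is the worst-case sum of the lengths of the segments of the trajectories of both agents, the worst case being taken over all terrains with the considered values of parameters and all adversarial decisions. Algorithm RVC: From its starting position $v$, the agent follows the half-line $\alpha$ pointing to the North, as far as possible. When it hits the boundary of a polygon $\mathcal{P}$ (i.e., either the external boundary of the terrain or the boundary of an obstacle), it traverses the entire boundary of $\mathcal{P}$. Then it computes the point $u$ which is the farthest point from $v$ in $\mathcal{P}\cap\alpha$. It goes around $\mathcal{P}$ until reaching $u$ again and progresses on $\alpha$, if possible. If this is impossible, the agent recognizes that it went around the boundary of $\mathcal{P}_0$. It then computes the northernmost points in $\mathcal{P}_0$. Finally, it traverses the boundary of $\mathcal{P}_0$ until reaching the easternmost of these points. *)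

theory Defs
  imports "HOL-Analysis.Analysis"
begin

section \<open>Polygons and terrains\<close>

text \<open>A polygon is given by the cyclic list of its vertices; the closing edge is implicit.\<close>

fun polyline :: "complex list \<Rightarrow> real \<Rightarrow> complex" where
  "polyline [] = linepath 0 0"
| "polyline [a] = linepath a a"
| "polyline [a, b] = linepath a b"
| "polyline (a # b # c # ps) = linepath a b +++ polyline (b # c # ps)"

definition is_polygon :: "complex list \<Rightarrow> bool" where
  "is_polygon vs \<longleftrightarrow> length vs \<ge> 3 \<and> simple_path (polyline (vs @ [hd vs]))"

definition poly_boundary :: "complex list \<Rightarrow> complex set" where
  "poly_boundary vs = path_image (polyline (vs @ [hd vs]))"

definition open_polygon :: "complex list \<Rightarrow> complex set" where
  "open_polygon vs = inside (poly_boundary vs)"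

definition closed_polygon :: "complex list \<Rightarrow> complex set" where
  "closed_polygon vs = poly_boundary vs \<union> inside (poly_boundary vs)"

definition route_length :: "complex list \<Rightarrow> real" where
  "route_length r = (\<Sum>i < length r - 1. dist (r ! i) (r ! Suc i))"

definition poly_perimeter :: "complex list \<Rightarrow> real" where
  "poly_perimeter vs = route_length (vs @ [hd vs])"

record terrain =
  outer :: "complex list"
  obstacles :: "complex list list"

text \<open>Only the open obstacles are required to be disjoint: their boundaries may touch each
  other and the boundary of the outer polygon.\<close>

definition is_terrain :: "terrain \<Rightarrow> bool" where
  "is_terrain T \<longleftrightarrow>
     is_polygon (outer T) \<and>
     (\<forall>Q \<in> set (obstacles T). is_polygon Q \<and> open_polygon Q \<subseteq> closed_polygon (outer T)) \<and>
     (\<forall>i < length (obstacles T). \<forall>j < length (obstacles T). i \<noteq> j \<longrightarrow>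
        open_polygon (obstacles T ! i) \<inter> open_polygon (obstacles T ! j) = {})"

definition terrain_set :: "terrain \<Rightarrow> complex set" where
  "terrain_set T = closed_polygon (outer T) - (\<Union>Q \<in> set (obstacles T). open_polygon Q)"

definition terrain_polygons :: "terrain \<Rightarrow> complex list set" where
  "terrain_polygons T = insert (outer T) (set (obstacles T))"

definition perimeter :: "terrain \<Rightarrow> real" where
  "perimeter T = poly_perimeter (outer T) + (\<Sum>Q \<leftarrow> obstacles T. poly_perimeter Q)"


section \<open>Agents, walks and rendezvous\<close>

record agent =
  start :: complex
  north :: complex
  unit_length :: real

definition is_agent :: "terrain \<Rightarrow> agent \<Rightarrow> bool" where
  "is_agent T A \<longleftrightarrow> start A \<in> terrain_set T \<and> norm (north A) = 1 \<and> unit_length A > 0"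

definition coherent :: "agent \<Rightarrow> agent \<Rightarrow> bool" where
  "coherent A B \<longleftrightarrow> north A = north B"

text \<open>North turned clockwise by a right angle.\<close>

definition east :: "agent \<Rightarrow> complex" where
  "east A = - \<i> * north A"

text \<open>A route is the list of the endpoints of its segments; zero-length segments are harmless.
  A walk along it is given by the times \<open>ts\<close> at which these endpoints are reached, together with
  the position \<open>f t\<close> at every time \<open>t \<ge> 0\<close>.\<close>

definition is_walk :: "complex list \<Rightarrow> real list \<Rightarrow> (real \<Rightarrow> complex) \<Rightarrow> bool" where
  "is_walk r ts f \<longleftrightarrow>
     r \<noteq> [] \<and> length ts = length r \<and> hd ts = 0 \<and> sorted_wrt (<) ts \<and>
     (\<forall>i. Suc i < length r \<longrightarrow>
        continuous_on {ts ! i .. ts ! Suc i} f \<and>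
        f ` {ts ! i .. ts ! Suc i} \<subseteq> closed_segment (r ! i) (r ! Suc i) \<and>
        f (ts ! i) = r ! i \<and> f (ts ! Suc i) = r ! Suc i) \<and>
     (\<forall>t \<ge> last ts. f t = last r)"

definition rendezvous_at :: "(real \<Rightarrow> complex) \<Rightarrow> (real \<Rightarrow> complex) \<Rightarrow> real \<Rightarrow> bool" where
  "rendezvous_at f g t \<longleftrightarrow> t \<ge> 0 \<and> f t = g t \<and> (\<forall>s. 0 \<le> s \<and> s < t \<longrightarrow> f s \<noteq> g s)"

text \<open>Length of the trajectory up to time \<open>t\<close>: the route segments completed by then and the
  portion from the beginning of the current segment to the current position.\<close>

definition trajectory_length ::
    "complex list \<Rightarrow> real list \<Rightarrow> (real \<Rightarrow> complex) \<Rightarrow> real \<Rightarrow> real" where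
  "trajectory_length r ts f t =
     (\<Sum>i < length r - 1.
        if ts ! Suc i \<le> t then dist (r ! i) (r ! Suc i)
        else if ts ! i \<le> t then dist (r ! i) (f t)
        else 0)"


section \<open>Algorithm RVC\<close>

text \<open>A complete tour of the boundary from \<open>x\<close> back to \<open>x\<close>, in either direction: \<open>x\<close> lies on the
  edge that enters the first vertex of the rotated (and possibly reversed) vertex list.\<close>

definition boundary_tour :: "complex list \<Rightarrow> complex \<Rightarrow> complex list \<Rightarrow> bool" where
  "boundary_tour vs x ps \<longleftrightarrow>
     (\<exists>k qs. (qs = rotate k vs \<or> qs = rotate k (rev vs)) \<and>
        x \<in> closed_segment (last qs) (hd qs) \<and> ps = x # qs @ [x])"

text \<open>A tour from \<open>x\<close> cut off at \<open>y\<close>. If \<open>y = x\<close>, both the trivial path and the whole tour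
  are allowed.\<close>

definition boundary_path :: "complex list \<Rightarrow> complex \<Rightarrow> complex \<Rightarrow> complex list \<Rightarrow> bool" where
  "boundary_path vs x y ps \<longleftrightarrow>
     (\<exists>qs m. boundary_tour vs x qs \<and> Suc m < length qs \<and>
        y \<in> closed_segment (qs ! m) (qs ! Suc m) \<and> ps = take (Suc m) qs @ [y])"

definition north_ray :: "agent \<Rightarrow> complex set" where
  "north_ray A = {start A + of_real s * north A | s. s \<ge> 0}"

text \<open>A step towards North from \<open>x\<close>, ending at the closest boundary point \<open>y\<close>.\<close>

definition north_step :: "terrain \<Rightarrow> agent \<Rightarrow> complex \<Rightarrow> complex \<Rightarrow> bool" where
  "north_step T A x y \<longleftrightarrow>
     (\<exists>s > 0. y = x + of_real s * north A) \<and>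
     open_segment x y \<subseteq> interior (terrain_set T) \<and>
     y \<in> frontier (terrain_set T)"

definition is_farthest :: "complex \<Rightarrow> complex set \<Rightarrow> complex \<Rightarrow> bool" where
  "is_farthest v S u \<longleftrightarrow> u \<in> S \<and> (\<forall>p \<in> S. dist v p \<le> dist v u)"

definition extremal_in :: "complex \<Rightarrow> complex set \<Rightarrow> complex set" where
  "extremal_in d S = {p \<in> S. \<forall>q \<in> S. q \<bullet> d \<le> p \<bullet> d}"

text \<open>A state \<open>(x, D, r)\<close>: the agent is at \<open>x\<close>, about to follow the ray, after having gone around
  the polygons in \<open>D\<close> along the route \<open>r\<close>. One round leads to the next polygon \<open>Q\<close>, around it,
  and on to \<open>u\<close>.

  The agent may be at a boundary point of a polygon that it has not gone around yet, namely at the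
  start, or at a point \<open>u\<close> where several polygons touch. It may then hit that polygon
  at distance zero; if it can also move towards North, both behaviours are allowed. The set \<open>D\<close>
  excludes hitting at \<open>u\<close> the polygon just traversed. If boundaries do not touch and the start is
  an interior point, only the directions of traversal (and the case \<open>y = x\<close> of
  \<open>boundary_path\<close>) are left open.\<close>

type_synonym rvc_state = "complex \<times> complex list set \<times> complex list"

inductive rvc_round :: "terrain \<Rightarrow> agent \<Rightarrow> rvc_state \<Rightarrow> rvc_state \<Rightarrow> bool"
  for T :: terrain and A :: agent where
  "y = x \<or> north_step T A x y \<Longrightarrow>
   Q \<in> terrain_polygons T - D \<Longrightarrow> y \<in> poly_boundary Q \<Longrightarrow>
   boundary_tour Q y ps \<Longrightarrow>
   is_farthest (start A) (closed_polygon Q \<inter> north_ray A) u \<Longrightarrow>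
   boundary_path Q y u qs \<Longrightarrow>
   rvc_round T A (x, D, r) (u, insert Q D, r @ ps @ qs)"

text \<open>No progress on the ray is possible: the agent goes to the easternmost of the northernmost
  points of the outer polygon.\<close>

inductive rvc_finish :: "terrain \<Rightarrow> agent \<Rightarrow> rvc_state \<Rightarrow> complex list \<Rightarrow> bool"
  for T :: terrain and A :: agent where
  "\<nexists>y. north_step T A x y \<Longrightarrow>
   \<nexists>Q. Q \<in> terrain_polygons T - D \<and> x \<in> poly_boundary Q \<Longrightarrow>
   w \<in> extremal_in (east A) (extremal_in (north A) (closed_polygon (outer T))) \<Longrightarrow>
   boundary_path (outer T) x w ps \<Longrightarrow>
   rvc_finish T A (x, D, r) (r @ ps)"

definition rvc_init :: "agent \<Rightarrow> rvc_state" where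
  "rvc_init A = (start A, {}, [start A])"

definition rvc_route :: "terrain \<Rightarrow> agent \<Rightarrow> complex list \<Rightarrow> bool" where
  "rvc_route T A r \<longleftrightarrow> (\<exists>s. (rvc_round T A)\<^sup>*\<^sup>* (rvc_init A) s \<and> rvc_finish T A s r)"

text \<open>Every execution can be continued until it has produced a complete route, and none runs
  forever.\<close>

definition rvc_terminates :: "terrain \<Rightarrow> agent \<Rightarrow> bool" where
  "rvc_terminates T A \<longleftrightarrow>
     (\<forall>s. (rvc_round T A)\<^sup>*\<^sup>* (rvc_init A) s \<longrightarrow>
        (\<exists>s'. rvc_round T A s s') \<or> (\<exists>r. rvc_finish T A s r)) \<and>
     (\<nexists>S :: nat \<Rightarrow> rvc_state. S 0 = rvc_init A \<and> (\<forall>n. rvc_round T A (S n) (S (Suc n))))"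

end

theory Submission
  imports Defs
begin

text \<open>Each round of the algorithm goes around a polygon that was not traversed before, at the cost
  of at most two tours of its boundary, and never moves backwards on the ray. So there are finitely
  many rounds, and a route is no longer than two tours of each polygon, the distance gained on the ray
  (at most the outer perimeter), and the final traversal of the outer boundary: at most four times
  the perimeter. Since the easternmost of the northernmost points depends only on the common compass,
  both routes end there, and the agents meet at the latest when both have stopped.\<close>

section \<open>Polygonal routes\<close>

text \<open>Indexing the edges, which \<open>polyline\<close> hides, allows a boundary point to be
  assigned to an edge at which a tour starts or is cut.\<close>

definition route_image :: "complex list \<Rightarrow> complex set" where
  "route_image r = (\<Union>i < length r - 1. closed_segment (r ! i) (r ! Suc i))"

lemma route_image_simps [simp]:
  "route_image [] = {}" "route_image [a] = {}"
  "route_image (a # b # ps) = closed_segment a b \<union> route_image (b # ps)"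
  by (simp_all add: route_image_def lessThan_Suc_eq_insert_0)

lemma route_length_simps [simp]:
  "route_length [] = 0" "route_length [a] = 0"
  "route_length (a # b # ps) = dist a b + route_length (b # ps)"
  by (simp_all add: route_length_def sum.lessThan_Suc_shift del: sum.lessThan_Suc)

lemma route_length_nonneg: "route_length r \<ge> 0"
  by (simp add: route_length_def sum_nonneg)

lemma route_image_append:
  "xs \<noteq> [] \<Longrightarrow> ys \<noteq> [] \<Longrightarrow>
   route_image (xs @ ys) = route_image xs \<union> closed_segment (last xs) (hd ys) \<union> route_image ys"
proof (induction xs rule: induct_list012)
  case (2 x)
  then show ?case by (cases ys) auto
qed auto

lemma route_length_append:
  "xs \<noteq> [] \<Longrightarrow> ys \<noteq> [] \<Longrightarrow>
   route_length (xs @ ys) = route_length xs + dist (last xs) (hd ys) + route_length ys"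
proof (induction xs rule: induct_list012)
  case (2 x)
  then show ?case by (cases ys) auto
qed auto

lemma route_length_rev: "route_length (rev r) = route_length r"
proof (induction r rule: induct_list012)
  case (3 x y zs)
  then show ?case
    using route_length_append[of "rev zs @ [y]" "[x]"] by (simp add: dist_commute)
qed auto

text \<open>The length bound for the images excludes the one-point list: there
  \<open>polyline\<close> is a constant path, whose image is a point, while
  \<open>route_image\<close> is empty.\<close>

lemma polyline_path:
  assumes "r \<noteq> []"
  shows pathstart_polyline: "pathstart (polyline r) = hd r"
    and pathfinish_polyline: "pathfinish (polyline r) = last r"
    and path_image_polyline: "length r \<ge> 2 \<Longrightarrow> path_image (polyline r) = route_image r"
proof -
  have "pathstart (polyline r) = hd r \<and> pathfinish (polyline r) = last r \<and>
        (length r \<ge> 2 \<longrightarrow> path_image (polyline r) = route_image r)"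
    using assms by (induction r rule: polyline.induct) (auto simp: path_image_join)
  then show "pathstart (polyline r) = hd r" "pathfinish (polyline r) = last r"
      "length r \<ge> 2 \<Longrightarrow> path_image (polyline r) = route_image r"
    by auto
qed

lemma route_image_rev: "route_image (rev r) = route_image r"
proof (induction r rule: induct_list012)
  case (3 x y zs)
  then show ?case
    using route_image_append[of "rev zs @ [y]" "[x]"] by (auto simp: closed_segment_commute)
qed auto

text \<open>A tour may run in either direction and from any vertex; this and the rotation lemmas
  below identify the edges it uses with those of the given vertex list.\<close>

lemma route_image_closed_rev:
  "vs \<noteq> [] \<Longrightarrow> route_image (rev vs @ [hd (rev vs)]) = route_image (vs @ [hd vs])"
  by (simp add: route_image_append route_image_rev hd_rev last_rev closed_segment_commute)

lemma route_image_closed_rotate1: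
  "vs \<noteq> [] \<Longrightarrow> route_image (rotate1 vs @ [hd (rotate1 vs)]) = route_image (vs @ [hd vs])"
proof (cases vs)
  case (Cons a ws)
  show ?thesis
  proof (cases ws)
    case Nil
    then show ?thesis using Cons by simp
  next
    \<comment> \<open>Rotation moves the edge from \<open>a\<close> to \<open>b\<close> from the
      front of the closed route to its closing position.\<close>
    case (Cons b ws')
    then show ?thesis
      using \<open>vs = a # ws\<close> route_image_append[of "b # ws' @ [a]" "[b]"] by auto
  qed
qed simp

lemma route_image_closed_rotate:
  assumes "vs \<noteq> []"
  shows "route_image (rotate k vs @ [hd (rotate k vs)]) = route_image (vs @ [hd vs])"
  by (induction k) (use assms in \<open>simp_all add: route_image_closed_rotate1\<close>)

lemma poly_perimeter_rotate1:
  "vs \<noteq> [] \<Longrightarrow> poly_perimeter (rotate1 vs) = poly_perimeter vs"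
  unfolding poly_perimeter_def
proof (cases vs)
  case (Cons a ws)
  show "route_length (rotate1 vs @ [hd (rotate1 vs)]) = route_length (vs @ [hd vs])"
  proof (cases ws)
    case Nil
    then show ?thesis using Cons by simp
  next
    case (Cons b ws')
    then show ?thesis
      using \<open>vs = a # ws\<close> route_length_append[of "b # ws' @ [a]" "[b]"] by auto
  qed
qed simp

lemma poly_perimeter_rotate:
  "vs \<noteq> [] \<Longrightarrow> poly_perimeter (rotate k vs) = poly_perimeter vs"
  by (induction k) (simp_all add: poly_perimeter_rotate1)

lemma poly_perimeter_conv:
  "vs \<noteq> [] \<Longrightarrow> poly_perimeter vs = route_length vs + dist (last vs) (hd vs)"
  by (simp add: poly_perimeter_def route_length_append)

lemma poly_perimeter_rev: "vs \<noteq> [] \<Longrightarrow> poly_perimeter (rev vs) = poly_perimeter vs"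
  by (simp add: poly_perimeter_conv route_length_rev hd_rev last_rev dist_commute)

lemma poly_perimeter_nonneg: "poly_perimeter vs \<ge> 0"
  by (simp add: poly_perimeter_def route_length_nonneg)

lemma poly_boundary_route_image:
  "vs \<noteq> [] \<Longrightarrow> poly_boundary vs = route_image (vs @ [hd vs])"
  unfolding poly_boundary_def by (rule path_image_polyline) (cases vs; simp)+

section \<open>Boundary tours\<close>

lemma dist_closed_segment:
  fixes a b x :: "'a::euclidean_space"
  assumes "x \<in> closed_segment a b"
  shows "dist a x + dist x b = dist a b"
  using assms between between_mem_segment by metis

text \<open>The point \<open>x\<close> splits the closing edge of \<open>qs\<close> into two pieces,
  one traversed first and the other last; their lengths add up to that edge.\<close>

lemma boundary_tour_length:
  assumes "vs \<noteq> []" "boundary_tour vs x ps"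
  shows "route_length ps = poly_perimeter vs"
proof -
  obtain k qs where qs: "qs = rotate k vs \<or> qs = rotate k (rev vs)"
    and x: "x \<in> closed_segment (last qs) (hd qs)" and ps: "ps = x # qs @ [x]"
    using assms unfolding boundary_tour_def by blast
  have ne: "qs \<noteq> []" using qs assms(1) by (metis rotate_is_Nil_conv rev_is_Nil_conv)
  have "poly_perimeter qs = poly_perimeter vs"
    using qs assms by (auto simp: poly_perimeter_rotate poly_perimeter_rev)
  moreover have "route_length ps = dist x (hd qs) + (route_length qs + dist (last qs) x)"
    using ne route_length_append[of "[x]" "qs @ [x]"] by (simp add: ps route_length_append)
  ultimately show ?thesis
    using dist_closed_segment[OF x] by (simp add: poly_perimeter_conv[OF ne])
qed

lemma boundary_tour_ends:
  assumes "boundary_tour vs x ps"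
  shows "ps \<noteq> []" "hd ps = x" "last ps = x"
  using assms unfolding boundary_tour_def by auto

lemma boundary_path_ends:
  assumes "boundary_path vs x y ps"
  shows "ps \<noteq> []" "hd ps = x" "last ps = y"
proof -
  obtain qs m where "boundary_tour vs x qs" "Suc m < length qs" "ps = take (Suc m) qs @ [y]"
    using assms unfolding boundary_path_def by blast
  then show "ps \<noteq> []" "hd ps = x" "last ps = y"
    using boundary_tour_ends[of vs x qs] by (auto simp: hd_append)
qed

text \<open>The cut shortens edge \<open>m\<close> to its part before \<open>y\<close> and drops a
  remainder of nonnegative length.\<close>

lemma route_length_cut:
  assumes "Suc m < length r" "y \<in> closed_segment (r ! m) (r ! Suc m)"
  shows "route_length (take (Suc m) r @ [y]) \<le> route_length r"
proof -
  have "route_length r = route_length (take (Suc m) r @ drop (Suc m) r)" by simp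
  also have "\<dots> = route_length (take (Suc m) r) + dist (r ! m) (r ! Suc m)
      + route_length (drop (Suc m) r)"
    using assms(1) by (subst route_length_append)
      (auto simp: hd_drop_conv_nth take_Suc_conv_app_nth simp del: append_take_drop_id)
  finally have *: "route_length r \<ge> route_length (take (Suc m) r) + dist (r ! m) (r ! Suc m)"
    using route_length_nonneg[of "drop (Suc m) r"] by linarith
  have "route_length (take (Suc m) r @ [y]) = route_length (take (Suc m) r) + dist (r ! m) y"
    using assms(1) by (subst route_length_append) (auto simp: take_Suc_conv_app_nth)
  with * dist_closed_segment[OF assms(2)] zero_le_dist[of y "r ! Suc m"]
  show ?thesis by linarith
qed

text \<open>The rule \<open>rvc_finish\<close> does not say that the agent stands on the outer
  boundary; this recovers it from the final path.\<close>

lemma boundary_path_start: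
  assumes "vs \<noteq> []" "boundary_path vs x y ps"
  shows "x \<in> poly_boundary vs"
proof -
  obtain k qs where qs: "qs = rotate k vs \<or> qs = rotate k (rev vs)"
    and x: "x \<in> closed_segment (last qs) (hd qs)"
    using assms(2) unfolding boundary_path_def boundary_tour_def by blast
  have ne: "qs \<noteq> []" using qs assms(1) by (metis rotate_is_Nil_conv rev_is_Nil_conv)
  have "x \<in> route_image (qs @ [hd qs])"
    using x ne by (simp add: route_image_append)
  then show ?thesis
    using qs assms(1) route_image_closed_rotate[of vs k] route_image_closed_rotate[of "rev vs" k]
      route_image_closed_rev[of vs]
    by (auto simp: poly_boundary_route_image)
qed

lemma boundary_path_length:
  assumes "vs \<noteq> []" "boundary_path vs x y ps"
  shows "route_length ps \<le> poly_perimeter vs"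
proof -
  obtain qs m where qs: "boundary_tour vs x qs" "Suc m < length qs"
      "y \<in> closed_segment (qs ! m) (qs ! Suc m)" "ps = take (Suc m) qs @ [y]"
    using assms unfolding boundary_path_def by blast
  then show ?thesis
    using route_length_cut boundary_tour_length[OF assms(1) qs(1)] by metis
qed

lemma dist_hd_last_le_route_length: "r \<noteq> [] \<Longrightarrow> dist (hd r) (last r) \<le> route_length r"
proof (induction r rule: induct_list012)
  case (3 x y zs)
  then have "dist y (last (y # zs)) \<le> route_length (y # zs)" by simp
  then show ?case
    using dist_triangle[of x "last (y # zs)" y] by simp
qed auto

text \<open>A suitable rotation brings an edge containing \<open>x\<close> into closing position,
  where a tour has to start. The second conjunct ensures that the tour can be cut at any boundary
  point.\<close>

lemma boundary_tour_exists:
  assumes "vs \<noteq> []" "x \<in> poly_boundary vs"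
  shows "\<exists>ps. boundary_tour vs x ps \<and> route_image ps = poly_boundary vs"
proof -
  have "x \<in> route_image (vs @ [hd vs])"
    using assms by (simp add: poly_boundary_route_image)
  then obtain i where i: "i < length vs"
    and xi: "x \<in> closed_segment ((vs @ [hd vs]) ! i) ((vs @ [hd vs]) ! Suc i)"
    unfolding route_image_def by auto
  \<comment> \<open>For the last edge, \<open>Suc i\<close> is the length of \<open>vs\<close>: the
    rotation wraps around to \<open>hd vs\<close>, which is also the appended vertex.\<close>
  have hd: "(vs @ [hd vs]) ! Suc i = hd (rotate (Suc i) vs)"
    using i assms(1)
    by (auto simp: hd_rotate_conv_nth[of vs "Suc i"] nth_append hd_conv_nth[of vs] mod_Suc
        simp del: rotate_Suc)
  have "last (rotate (Suc i) vs) = hd (rotate i vs)"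
  proof -
    have "last (rotate1 zs) = hd zs" if "zs \<noteq> []" for zs :: "complex list"
      using that by (cases zs) auto
    then show ?thesis using assms(1) by simp
  qed
  also have "\<dots> = (vs @ [hd vs]) ! i"
    using i assms(1) by (auto simp: hd_rotate_conv_nth nth_append)
  finally have x: "x \<in> closed_segment (last (rotate (Suc i) vs)) (hd (rotate (Suc i) vs))"
    using xi hd by simp
  define qs where "qs = rotate (Suc i) vs"
  have ne: "qs \<noteq> []" using assms by (simp add: qs_def)
  have tour: "boundary_tour vs x (x # qs @ [x])"
    unfolding boundary_tour_def using x qs_def by blast
  have "route_image (x # qs @ [x]) =
      closed_segment x (hd qs) \<union> (route_image qs \<union> closed_segment (last qs) x)"
    using ne route_image_append[of "[x]" "qs @ [x]"] by (simp add: route_image_append)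
  also have "\<dots> = route_image qs \<union> closed_segment (last qs) (hd qs)"
    using Un_closed_segment[of x "last qs" "hd qs"] x by (auto simp: qs_def)
  also have "\<dots> = route_image (qs @ [hd qs])"
    using ne by (simp add: route_image_append)
  also have "\<dots> = poly_boundary vs"
    unfolding qs_def route_image_closed_rotate[OF assms(1)]
    using assms(1) by (simp add: poly_boundary_route_image)
  finally show ?thesis using tour by blast
qed

lemma boundary_path_exists:
  assumes "vs \<noteq> []" "x \<in> poly_boundary vs" "y \<in> poly_boundary vs"
  shows "\<exists>ps. boundary_path vs x y ps"
proof -
  obtain qs where qs: "boundary_tour vs x qs" "route_image qs = poly_boundary vs"
    using boundary_tour_exists[OF assms(1,2)] by blast
  then obtain m where "m < length qs - 1" "y \<in> closed_segment (qs ! m) (qs ! Suc m)"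
    using assms(3) unfolding route_image_def by auto
  then show ?thesis
    using qs(1) unfolding boundary_path_def by (metis less_diff_conv Suc_eq_plus1)
qed

section \<open>Polygons\<close>

lemma polygon_nonempty: "is_polygon vs \<Longrightarrow> vs \<noteq> []"
  by (auto simp: is_polygon_def)

text \<open>The vertex list is closed up by its own head, so the boundary is a simple closed curve
  and the Jordan curve theorem applies.\<close>

lemma polygon_Jordan:
  assumes "is_polygon vs"
  shows "open (open_polygon vs)" "open_polygon vs \<noteq> {}" "bounded (open_polygon vs)"
    "frontier (open_polygon vs) = poly_boundary vs"
    "frontier (outside (poly_boundary vs)) = poly_boundary vs"
    "compact (poly_boundary vs)"
proof -
  let ?c = "polyline (vs @ [hd vs])"
  have "simple_path ?c" using assms by (simp add: is_polygon_def)
  moreover have "pathfinish ?c = pathstart ?c"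
    using polygon_nonempty[OF assms] by (simp add: pathfinish_polyline pathstart_polyline)
  ultimately show "open (open_polygon vs)" "open_polygon vs \<noteq> {}" "bounded (open_polygon vs)"
      "frontier (open_polygon vs) = poly_boundary vs"
      "frontier (outside (poly_boundary vs)) = poly_boundary vs"
      "compact (poly_boundary vs)"
    unfolding open_polygon_def poly_boundary_def
    using Jordan_inside_outside[of ?c] compact_simple_path_image[of ?c] by blast+
qed

lemma closed_polygon_eq: "closed_polygon vs = poly_boundary vs \<union> open_polygon vs"
  by (simp add: closed_polygon_def open_polygon_def)

lemma closed_polygon_closure:
  "is_polygon vs \<Longrightarrow> closed_polygon vs = closure (open_polygon vs)"
  unfolding closed_polygon_eq closure_Un_frontier by (auto simp: polygon_Jordan(4))

lemma compact_closed_polygon: "is_polygon vs \<Longrightarrow> compact (closed_polygon vs)"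
  by (simp add: closed_polygon_closure polygon_Jordan(3))

lemma open_boundary_disjoint: "open_polygon vs \<inter> poly_boundary vs = {}"
  unfolding open_polygon_def by (metis inside_no_overlap Int_commute)

text \<open>By the Jordan curve theorem each boundary point is also a limit of the outside, hence
  not interior to the closed polygon.\<close>

lemma interior_closed_polygon:
  assumes "is_polygon vs"
  shows "interior (closed_polygon vs) = open_polygon vs"
proof
  have "poly_boundary vs \<subseteq> closure (outside (poly_boundary vs))"
    using polygon_Jordan(5)[OF assms] by (metis frontier_def Diff_subset)
  moreover have "closed_polygon vs = - outside (poly_boundary vs)"
    unfolding closed_polygon_def by (rule union_with_inside)
  ultimately have "interior (closed_polygon vs) \<inter> poly_boundary vs = {}"
    by (auto simp: interior_complement)
  then show "interior (closed_polygon vs) \<subseteq> open_polygon vs"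
    using interior_subset[of "closed_polygon vs"] by (auto simp: closed_polygon_eq)
  show "open_polygon vs \<subseteq> interior (closed_polygon vs)"
    by (rule interior_maximal) (auto simp: closed_polygon_eq polygon_Jordan(1)[OF assms])
qed

text \<open>A boundary path from \<open>x\<close> to any other boundary point is at most a perimeter
  long, so the ball contains the boundary; being convex, it also contains the inside.\<close>

lemma closed_polygon_subset_cball:
  assumes "is_polygon vs" "x \<in> poly_boundary vs"
  shows "closed_polygon vs \<subseteq> cball x (poly_perimeter vs)"
proof -
  have "dist x y \<le> poly_perimeter vs" if y: "y \<in> poly_boundary vs" for y
  proof -
    obtain ps where ps: "boundary_path vs x y ps"
      using boundary_path_exists[OF polygon_nonempty[OF assms(1)] assms(2) y] by blast
    then show ?thesis
      using boundary_path_length[OF polygon_nonempty[OF assms(1)] ps]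
        dist_hd_last_le_route_length[of ps] boundary_path_ends[OF ps] by simp
  qed
  then have "poly_boundary vs \<subseteq> cball x (poly_perimeter vs)" by auto
  then have "- cball x (poly_perimeter vs) \<subseteq> outside (poly_boundary vs)"
    by (intro outside_subset_convex) auto
  moreover have "closed_polygon vs = - outside (poly_boundary vs)"
    unfolding closed_polygon_def by (rule union_with_inside)
  ultimately show ?thesis by auto
qed

section \<open>Walks\<close>

text \<open>The continuous pieces agree at the times in \<open>ts\<close> and are glued by
  induction; after \<open>last ts\<close> the walk is constant. The inert phase is included because
  a meeting may occur then.\<close>

lemma walk_continuous:
  assumes "is_walk r ts f"
  shows "continuous_on {0..} f"
proof -
  have w: "r \<noteq> []" "length ts = length r" "ts ! 0 = 0" "sorted_wrt (<) ts"
    "\<And>i. Suc i < length r \<Longrightarrow> continuous_on {ts ! i .. ts ! Suc i} f"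
    "\<And>t. t \<ge> last ts \<Longrightarrow> f t = last r"
    using assms hd_conv_nth[of ts] unfolding is_walk_def by force+
  have pos: "0 \<le> ts ! n" if "n < length r" for n
    using w that sorted_wrt_nth_less[of "(<)" ts 0 n] by (cases "n = 0") auto
  have *: "continuous_on {0..ts ! n} f" if "n < length r" for n
    using that
  proof (induction n)
    case 0
    then show ?case using w by simp
  next
    case (Suc n)
    have "ts ! n \<le> ts ! Suc n"
      using w Suc.prems sorted_wrt_nth_less[of "(<)" ts n "Suc n"] by auto
    then have "{0..ts ! Suc n} = {0..ts ! n} \<union> {ts ! n..ts ! Suc n}"
      using pos[of n] Suc.prems by auto
    then show ?case
      using Suc w(5)[of n] by (auto intro!: continuous_on_closed_Un)
  qed
  have last: "last ts = ts ! (length r - 1)"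
    using w by (metis last_conv_nth length_0_conv)
  then have "{0..} = {0..last ts} \<union> {last ts..}"
    using pos[of "length r - 1"] w(1) by auto
  moreover have "continuous_on {last ts..} f"
    using w(6) by (subst continuous_on_cong[OF refl, of _ _ "\<lambda>_. last r"]) auto
  moreover have "continuous_on {0..last ts} f"
    using *[of "length r - 1"] w(1) last by simp
  ultimately show ?thesis
    by (metis continuous_on_closed_Un closed_atLeastAtMost closed_atLeast)
qed

text \<open>The comparison is made edge by edge: during its time interval the walk stays on the
  edge, so a partial edge contributes at most the whole one.\<close>

lemma trajectory_length_le:
  assumes "is_walk r ts f"
  shows "trajectory_length r ts f t \<le> route_length r"
  unfolding trajectory_length_def route_length_def
proof (rule sum_mono)
  fix i assume "i \<in> {..<length r - 1}"
  then have "f ` {ts ! i .. ts ! Suc i} \<subseteq> closed_segment (r ! i) (r ! Suc i)"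
    using assms unfolding is_walk_def by auto
  then have "dist (r ! i) (f t) \<le> dist (r ! i) (r ! Suc i)" if "ts ! i \<le> t" "t < ts ! Suc i"
    using that dist_in_closed_segment[of "f t" "r ! i" "r ! Suc i"]
    by (auto simp: dist_commute image_subset_iff)
  then show "(if ts ! Suc i \<le> t then dist (r ! i) (r ! Suc i)
        else if ts ! i \<le> t then dist (r ! i) (f t) else 0) \<le> dist (r ! i) (r ! Suc i)"
    by auto
qed

text \<open>Rendezvous is the first meeting. The meeting times up to \<open>t0\<close> form a
  nonempty compact set, which has a least element.\<close>

lemma rendezvous_exists:
  assumes "continuous_on {0..} f" "continuous_on {0..} g" "t0 \<ge> 0" "f t0 = g t0"
  shows "\<exists>t. rendezvous_at f g t"
proof -
  define K where "K = {0..t0} \<inter> (\<lambda>t. f t - g t) -` {0}"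
  have "continuous_on {0..t0} (\<lambda>t. f t - g t)"
    using assms(1,2) by (intro continuous_on_diff) (auto elim: continuous_on_subset)
  then have "closed K"
    unfolding K_def by (intro continuous_closed_preimage) auto
  then have "compact K"
    using compact_Int_closed[of "{0..t0}" K] by (simp add: K_def Int_absorb1)
  moreover have "t0 \<in> K" using assms by (simp add: K_def)
  ultimately obtain t where t: "t \<in> K" "\<And>s. s \<in> K \<Longrightarrow> t \<le> s"
    using compact_attains_inf[of K] by blast
  have "f s \<noteq> g s" if "0 \<le> s" "s < t" for s
    using t(2)[of s] t(1) that by (auto simp: K_def)
  then show ?thesis
    using t(1) by (auto simp: rendezvous_at_def K_def)
qed

section \<open>Executions of the algorithm\<close>

context
  fixes T :: terrain and A :: agent
  assumes terrain: "is_terrain T" and agent: "is_agent T A"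
begin

section \<open>Topology of the terrain\<close>

lemma terrain_polygonD: "Q \<in> terrain_polygons T \<Longrightarrow> is_polygon Q"
  using terrain by (auto simp: is_terrain_def terrain_polygons_def)

lemma finite_terrain_polygons: "finite (terrain_polygons T)"
  by (simp add: terrain_polygons_def)

lemma outer_in_terrain_polygons: "outer T \<in> terrain_polygons T"
  by (simp add: terrain_polygons_def)

lemma obstacles_disjoint:
  assumes "Q \<in> set (obstacles T)" "Q' \<in> set (obstacles T)" "Q \<noteq> Q'"
  shows "open_polygon Q \<inter> open_polygon Q' = {}"
  using assms terrain unfolding is_terrain_def by (metis in_set_conv_nth)

lemma terrain_subset_outer: "terrain_set T \<subseteq> closed_polygon (outer T)"
  by (auto simp: terrain_set_def)

text \<open>A boundary point is a limit of its open polygon. An open obstacle around it would meet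
  this polygon, against disjointness if \<open>Q\<close> is an obstacle; if \<open>Q\<close> is the
  outer polygon, open obstacles lie in its interior and miss its boundary.\<close>

lemma poly_boundary_in_terrain:
  assumes "Q \<in> terrain_polygons T"
  shows "poly_boundary Q \<subseteq> terrain_set T"
proof
  fix x assume x: "x \<in> poly_boundary Q"
  have o: "is_polygon (outer T)" using terrain by (simp add: is_terrain_def)
  have Q: "is_polygon Q" by (rule terrain_polygonD[OF assms])
  have xQ: "x \<in> closure (open_polygon Q)"
    using x closed_polygon_closure[OF Q] by (auto simp: closed_polygon_eq)
  have "open_polygon Q \<subseteq> closed_polygon (outer T)"
    using assms terrain by (auto simp: terrain_polygons_def is_terrain_def closed_polygon_eq)
  then have "x \<in> closed_polygon (outer T)"
    using xQ compact_imp_closed[OF compact_closed_polygon[OF o]] closure_minimal by blast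
  moreover have "x \<notin> open_polygon Q'" if Q': "Q' \<in> set (obstacles T)" for Q'
  proof
    assume xQ': "x \<in> open_polygon Q'"
    have op: "open (open_polygon Q')" and sub: "open_polygon Q' \<subseteq> closed_polygon (outer T)"
      using Q' terrain polygon_Jordan(1) by (auto simp: is_terrain_def)
    then have "open_polygon Q' \<subseteq> open_polygon (outer T)"
      using interior_closed_polygon[OF o] interior_maximal by metis
    then have "Q \<noteq> outer T" using x xQ' open_boundary_disjoint by blast
    then have "Q \<in> set (obstacles T)" using assms by (auto simp: terrain_polygons_def)
    moreover have "Q \<noteq> Q'" using x xQ' open_boundary_disjoint by blast
    ultimately have "open_polygon Q' \<inter> open_polygon Q = {}"
      using Q' obstacles_disjoint by blast
    then show False
      using open_Int_closure_eq_empty[OF op] xQ xQ' by blast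
  qed
  ultimately show "x \<in> terrain_set T" by (auto simp: terrain_set_def)
qed

text \<open>Removing the closed obstacles instead of the open ones leaves an open subset of the
  terrain.\<close>

lemma in_interior_terrain:
  assumes "x \<in> open_polygon (outer T)" "\<forall>Q \<in> set (obstacles T). x \<notin> closed_polygon Q"
  shows "x \<in> interior (terrain_set T)"
proof (rule interiorI)
  let ?G = "open_polygon (outer T) - (\<Union>Q \<in> set (obstacles T). closed_polygon Q)"
  have "closed (\<Union>Q \<in> set (obstacles T). closed_polygon Q)"
    using terrain_polygonD
    by (intro closed_UN) (auto simp: terrain_polygons_def intro!: compact_imp_closed compact_closed_polygon)
  then show "open ?G"
    using polygon_Jordan(1)[OF terrain_polygonD[OF outer_in_terrain_polygons]] by (rule open_Diff[rotated])
  show "x \<in> ?G" using assms by blast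
  show "?G \<subseteq> terrain_set T" by (auto simp: terrain_set_def closed_polygon_eq)
qed

lemma closed_terrain: "closed (terrain_set T)"
  unfolding terrain_set_def
  using terrain polygon_Jordan(1)
  by (intro closed_Diff open_UN compact_imp_closed compact_closed_polygon) (auto simp: is_terrain_def)

text \<open>This supplies the polygon hit at the end of a northward step. A terrain point off all
  boundaries avoids the closed obstacles and is therefore interior.\<close>

lemma frontier_terrain:
  assumes "x \<in> frontier (terrain_set T)"
  shows "\<exists>Q \<in> terrain_polygons T. x \<in> poly_boundary Q"
proof (rule ccontr)
  assume neg: "\<not> ?thesis"
  have x: "x \<in> terrain_set T" "x \<notin> interior (terrain_set T)"
    using assms closed_terrain by (auto simp: frontier_def)
  then have "x \<in> open_polygon (outer T)" "\<forall>Q \<in> set (obstacles T). x \<notin> closed_polygon Q"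
    using neg by (auto simp: terrain_set_def closed_polygon_eq terrain_polygons_def)
  then show False using in_interior_terrain x(2) by blast
qed

section \<open>The ray towards North and steps along it\<close>

lemma norm_north: "norm (north A) = 1"
  using agent by (simp add: is_agent_def)

lemma dist_north: "dist x (x + of_real s * north A) = \<bar>s\<bar>"
  by (simp add: dist_norm norm_mult norm_north)

text \<open>North is a unit vector, so the parameter of a ray point is its distance from the start.
  Progress along the ray is measured by this distance throughout.\<close>

lemma north_rayE:
  assumes "x \<in> north_ray A"
  shows "x = start A + of_real (dist (start A) x) * north A"
  using assms dist_north[of "start A"] by (auto simp: north_ray_def)

lemma north_ray_step:
  assumes "x \<in> north_ray A" "s \<ge> 0"
  shows "x + of_real s * north A \<in> north_ray A"
    and "dist (start A) (x + of_real s * north A) = dist (start A) x + s"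
proof -
  have "x + of_real s * north A = start A + of_real (dist (start A) x + s) * north A"
    using north_rayE[OF assms(1)] by (metis add.assoc distrib_right of_real_add)
  then show "x + of_real s * north A \<in> north_ray A"
    "dist (start A) (x + of_real s * north A) = dist (start A) x + s"
    using assms(2) dist_north[of "start A" "dist (start A) x + s"]
    by (auto simp: north_ray_def intro!: exI[of _ "dist (start A) x + s"])
qed

lemma continuous_on_north: "continuous_on S (\<lambda>s. x + of_real s * north A)"
  by (intro continuous_intros)

text \<open>The ray itself is not compact, so its parameters are restricted to
  \<open>{0..M}\<close>, where \<open>M\<close> bounds the distance from the start to points of the
  polygon; the maximum is then attained.\<close>

lemma farthest_exists:
  assumes "is_polygon Q" "y \<in> closed_polygon Q" "y \<in> north_ray A"
  shows "\<exists>u. is_farthest (start A) (closed_polygon Q \<inter> north_ray A) u"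
proof -
  let ?f = "\<lambda>s. start A + of_real s * north A"
  have cl: "closed (closed_polygon Q)" and bd: "bounded (closed_polygon Q)"
    using compact_closed_polygon[OF assms(1)] by (auto simp: compact_imp_closed compact_imp_bounded)
  obtain M where M: "\<And>p. p \<in> closed_polygon Q \<Longrightarrow> dist (start A) p \<le> M"
    using bd bounded_any_center by blast
  define K where "K = {0..M} \<inter> ?f -` closed_polygon Q"
  have "closed K"
    unfolding K_def by (intro continuous_closed_preimage continuous_on_north cl) auto
  then have "compact K"
    using compact_Int_closed[of "{0..M}" K] by (simp add: K_def Int_absorb1)
  moreover have mem: "dist (start A) p \<in> K" if "p \<in> closed_polygon Q" "p \<in> north_ray A" for p
    using M[OF that(1)] that(1) north_rayE[OF that(2)] by (simp add: K_def)
  then have "K \<noteq> {}" using assms by blast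
  ultimately obtain t where t: "t \<in> K" "\<And>s. s \<in> K \<Longrightarrow> s \<le> t"
    using compact_attains_sup[of K] by blast
  then have "?f t \<in> closed_polygon Q \<inter> north_ray A" "dist (start A) (?f t) = t"
    using dist_north[of "start A" t] by (auto simp: K_def north_ray_def)
  then show ?thesis
    using t(2) mem unfolding is_farthest_def by (metis IntD1 IntD2)
qed

text \<open>From a point of the open polygon the ray could be followed a little further inside it.
  Hence the agent can reach \<open>u\<close> along the boundary.\<close>

lemma farthest_in_boundary:
  assumes "is_polygon Q" "is_farthest (start A) (closed_polygon Q \<inter> north_ray A) u"
  shows "u \<in> poly_boundary Q"
proof (rule ccontr)
  assume "u \<notin> poly_boundary Q"
  then have u: "u \<in> open_polygon Q" "u \<in> north_ray A"
    using assms(2) by (auto simp: is_farthest_def closed_polygon_eq)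
  obtain e where e: "e > 0" "cball u e \<subseteq> open_polygon Q"
    using polygon_Jordan(1)[OF assms(1)] u(1) open_contains_cball by blast
  let ?p = "u + of_real e * north A"
  have "?p \<in> cball u e" using e(1) dist_north[of u e] by simp
  then have "?p \<in> closed_polygon Q \<inter> north_ray A"
    using e north_ray_step(1)[OF u(2), of e] by (auto simp: closed_polygon_eq)
  then have "dist (start A) ?p \<le> dist (start A) u"
    using assms(2) by (simp add: is_farthest_def)
  then show False using north_ray_step(2)[OF u(2), of e] e(1) by simp
qed

text \<open>Obstacles containing \<open>x\<close> are avoided by the rest of the ray, by
  \<open>free\<close>; the others are closed sets off \<open>x\<close> and stay away from a small
  ball. So a short initial piece of the ray is interior, and the first frontier point after it ends
  the step.\<close>

lemma north_step_exists:
  assumes x: "x \<in> open_polygon (outer T)"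
    and free: "\<And>Q s. Q \<in> set (obstacles T) \<Longrightarrow> x \<in> closed_polygon Q \<Longrightarrow> s > 0 \<Longrightarrow>
      x + of_real s * north A \<notin> closed_polygon Q"
  shows "\<exists>y. north_step T A x y"
proof -
  let ?f = "\<lambda>s. x + of_real s * north A"
  have o: "is_polygon (outer T)" using terrain by (simp add: is_terrain_def)
  let ?U = "open_polygon (outer T) - (\<Union>Q \<in> {Q \<in> set (obstacles T). x \<notin> closed_polygon Q}. closed_polygon Q)"
  have "closed (\<Union>Q \<in> {Q \<in> set (obstacles T). x \<notin> closed_polygon Q}. closed_polygon Q)"
    using terrain_polygonD
    by (intro closed_UN) (auto simp: terrain_polygons_def intro!: compact_imp_closed compact_closed_polygon)
  then have "open ?U"
    using polygon_Jordan(1)[OF o] by (rule open_Diff[rotated])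
  moreover have "x \<in> ?U" using x by blast
  ultimately obtain e where e: "e > 0" "cball x e \<subseteq> ?U"
    using open_contains_cball by blast
  have start_int: "?f s \<in> interior (terrain_set T)" if "0 < s" "s \<le> e" for s
  proof -
    have "?f s \<in> cball x e" using that dist_north[of x s] by simp
    then have U: "?f s \<in> ?U" using e(2) by blast
    then show ?thesis
      using free that(1) by (intro in_interior_terrain) blast+
  qed
  obtain M where M: "\<And>p. p \<in> closed_polygon (outer T) \<Longrightarrow> dist x p \<le> M"
    using compact_imp_bounded[OF compact_closed_polygon[OF o]] bounded_any_center by blast
  \<comment> \<open>Beyond distance \<open>M\<close> the ray is outside the outer polygon; the
    maximum with \<open>e\<close> ensures \<open>e \<le> N\<close>.\<close>
  define N where "N = max e (M + 1)"
  have "\<not> dist x (?f N) \<le> M"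
    using e(1) by (simp add: dist_north N_def)
  then have N: "?f N \<notin> terrain_set T"
    using M terrain_subset_outer by blast
  have hit: "\<exists>s. a \<le> s \<and> s \<le> b \<and> ?f s \<in> frontier (terrain_set T)"
    if "a \<le> b" "?f a \<in> terrain_set T" "?f b \<notin> terrain_set T" for a b
  proof -
    have "connected (?f ` {a..b})"
      by (intro connected_continuous_image continuous_on_north) simp
    then have "?f ` {a..b} \<inter> frontier (terrain_set T) \<noteq> {}"
    proof (rule connected_Int_frontier)
      show "?f ` {a..b} \<inter> terrain_set T \<noteq> {}" "?f ` {a..b} - terrain_set T \<noteq> {}"
        using that atLeastAtMost_iff order_refl by blast+
    qed
    then show ?thesis by auto
  qed
  have in_terrain: "?f e \<in> terrain_set T"
    using start_int[of e] e(1) interior_subset by blast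
  \<comment> \<open>The search starts at \<open>e\<close> and not at 0, since \<open>x\<close>
    itself may be a frontier point.\<close>
  define K where "K = {e..N} \<inter> ?f -` frontier (terrain_set T)"
  have "closed K"
    unfolding K_def by (intro continuous_closed_preimage continuous_on_north) auto
  then have "compact K"
    using compact_Int_closed[of "{e..N}" K] by (simp add: K_def Int_absorb1)
  moreover have "K \<noteq> {}"
    using hit[of e N] in_terrain N by (auto simp: K_def N_def)
  ultimately obtain t where t: "t \<in> K" "\<And>s. s \<in> K \<Longrightarrow> t \<le> s"
    using compact_attains_inf[of K] by blast
  have t': "e \<le> t" "t \<le> N" "?f t \<in> frontier (terrain_set T)"
    using t(1) by (auto simp: K_def)
  have inner: "?f s \<in> interior (terrain_set T)" if s: "0 < s" "s < t" for s
  proof (cases "s \<le> e")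
    case False
    \<comment> \<open>Between \<open>e\<close> and \<open>s\<close> there is no frontier point, so
      by \<open>hit\<close> the ray cannot be off the terrain at \<open>s\<close>.\<close>
    have no: "?f s' \<notin> frontier (terrain_set T)" if "e \<le> s'" "s' \<le> s" for s'
      using t(2)[of s'] t' s that by (auto simp: K_def)
    then have "?f s \<in> terrain_set T"
      using hit[of e s] False in_terrain by force
    then show ?thesis
      using no[of s] False closure_subset by (auto simp: frontier_def)
  qed (use start_int s in auto)
  have "open_segment x (?f t) \<subseteq> interior (terrain_set T)"
  proof
    fix z assume "z \<in> open_segment x (?f t)"
    then obtain v where v: "0 < v" "v < 1" "z = (1 - v) *\<^sub>R x + v *\<^sub>R ?f t"
      by (auto simp: in_segment)
    then have "z = ?f (v * t)"
      by (simp add: scaleR_conv_of_real algebra_simps)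
    moreover have "0 < v * t" "v * t < t" using v t'(1) e(1) by auto
    ultimately show "z \<in> interior (terrain_set T)" using inner by blast
  qed
  then show ?thesis
    using t' e(1) unfolding north_step_def
    by (intro exI[of _ "?f t"] conjI exI[of _ t]) auto
qed

section \<open>The invariant of the rounds\<close>

text \<open>The clause on \<open>D\<close> says that the ray beyond \<open>x\<close> is free of the
  polygons already traversed. In the length bound, the distance from the start pays for the
  northward steps, and each traversed polygon pays twice: for its tour and for the path to
  \<open>u\<close>.\<close>

definition rvc_invariant :: "complex \<Rightarrow> complex list set \<Rightarrow> complex list \<Rightarrow> bool" where
  "rvc_invariant x D r \<longleftrightarrow>
     r \<noteq> [] \<and> last r = x \<and> x \<in> north_ray A \<and> x \<in> terrain_set T \<and> D \<subseteq> terrain_polygons T \<and>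
     (\<forall>Q \<in> D. \<forall>p \<in> closed_polygon Q \<inter> north_ray A. dist (start A) p \<le> dist (start A) x) \<and>
     route_length r \<le> dist (start A) x + 2 * (\<Sum>Q \<in> D. poly_perimeter Q)"

lemma rvc_invariant_init: "rvc_invariant (start A) {} [start A]"
proof -
  have "start A \<in> north_ray A"
    unfolding north_ray_def by (auto intro!: exI[of _ 0])
  then show ?thesis
    using agent by (simp add: rvc_invariant_def is_agent_def)
qed

lemma north_step_ray:
  assumes "x \<in> north_ray A" "y = x \<or> north_step T A x y"
  shows "y \<in> north_ray A" "dist (start A) y = dist (start A) x + dist x y"
proof -
  obtain s where s: "s \<ge> 0" "y = x + of_real s * north A"
  proof (cases "y = x")
    case True
    then show thesis using that[of 0] by simp
  next
    case False
    then show thesis using assms(2) that by (auto simp: north_step_def intro: less_imp_le)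
  qed
  then show "y \<in> north_ray A" "dist (start A) y = dist (start A) x + dist x y"
    using north_ray_step[OF assms(1) s(1)] dist_north[of x s] by simp_all
qed

text \<open>The distance from the start does not decrease from \<open>x\<close> to \<open>y\<close>
  and from \<open>y\<close> to \<open>x'\<close>. So the bounds for polygons in \<open>D\<close>
  persist, while the one for \<open>Q\<close> is the choice of the farthest point.\<close>

lemma rvc_invariant_round:
  assumes "rvc_round T A (x, D, r) (x', D', r')" "rvc_invariant x D r"
  shows "rvc_invariant x' D' r'"
  using assms(1)
proof cases
  case (1 y Q ps qs)
  have Q: "is_polygon Q" using 1 terrain_polygonD by blast
  note ne = polygon_nonempty[OF Q]
  have inv: "r \<noteq> []" "last r = x" "x \<in> north_ray A" "D \<subseteq> terrain_polygons T"
    "\<And>Q p. Q \<in> D \<Longrightarrow> p \<in> closed_polygon Q \<inter> north_ray A \<Longrightarrow> dist (start A) p \<le> dist (start A) x"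
    "route_length r \<le> dist (start A) x + 2 * (\<Sum>Q \<in> D. poly_perimeter Q)"
    using assms(2) by (auto simp: rvc_invariant_def)
  have y: "y \<in> north_ray A" "dist (start A) y = dist (start A) x + dist x y"
    using north_step_ray[OF inv(3)] 1 by blast+
  have u: "x' \<in> poly_boundary Q" using farthest_in_boundary[OF Q] 1 by blast
  have far: "x' \<in> north_ray A"
      "\<And>p. p \<in> closed_polygon Q \<inter> north_ray A \<Longrightarrow> dist (start A) p \<le> dist (start A) x'"
    using 1 by (auto simp: is_farthest_def)
  then have yu: "dist (start A) y \<le> dist (start A) x'"
    using y(1) \<open>y \<in> poly_boundary Q\<close> by (simp add: closed_polygon_eq)
  then have xu: "dist (start A) x \<le> dist (start A) x'"
    using y(2) zero_le_dist[of x y] by linarith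
  note tour = boundary_tour_ends[OF \<open>boundary_tour Q y ps\<close>]
    boundary_tour_length[OF ne \<open>boundary_tour Q y ps\<close>]
  note path = boundary_path_ends[OF \<open>boundary_path Q y x' qs\<close>]
    boundary_path_length[OF ne \<open>boundary_path Q y x' qs\<close>]
  \<comment> \<open>The junction of \<open>r\<close> and \<open>ps\<close> is the northward step;
    that of \<open>ps\<close> and \<open>qs\<close> has length 0, both being at
    \<open>y\<close>.\<close>
  have "route_length r' = route_length r + dist x y + (route_length ps + route_length qs)"
    using 1 inv(1,2) tour(1-3) path(1-3) by (simp add: route_length_append)
  \<comment> \<open>Here it matters that \<open>Q\<close> is not in \<open>D\<close>: its perimeter
    is a new term of the sum.\<close>
  moreover have "(\<Sum>Q \<in> D'. poly_perimeter Q) = poly_perimeter Q + (\<Sum>Q \<in> D. poly_perimeter Q)"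
    using 1 finite_subset[OF inv(4) finite_terrain_polygons] by simp
  ultimately have "route_length r' \<le> dist (start A) x' + 2 * (\<Sum>Q \<in> D'. poly_perimeter Q)"
    using inv(6) y(2) yu tour(4) path(4) by (simp add: algebra_simps)
  moreover have "x' \<in> terrain_set T"
    using u 1 poly_boundary_in_terrain by blast
  moreover have "dist (start A) p \<le> dist (start A) x'"
    if "R \<in> D'" "p \<in> closed_polygon R \<inter> north_ray A" for R p
    using that far(2) order_trans[OF inv(5) xu] 1 by blast
  ultimately show ?thesis
    using 1 inv(1,4) path(1,3) far(1) by (auto simp: rvc_invariant_def)
qed

lemma rvc_invariant_reachable:
  assumes "(rvc_round T A)\<^sup>*\<^sup>* (rvc_init A) (x, D, r)"
  shows "rvc_invariant x D r"
proof -
  have "case s of (x, D, r) \<Rightarrow> rvc_invariant x D r"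
    if "(rvc_round T A)\<^sup>*\<^sup>* (rvc_init A) s" for s
    using that
  proof induction
    case base
    then show ?case using rvc_invariant_init by (simp add: rvc_init_def)
  next
    case (step s s')
    then show ?case using rvc_invariant_round by (cases s; cases s') auto
  qed
  from this[OF assms] show ?thesis by simp
qed

section \<open>Progress and termination\<close>

lemma rvc_round_exists:
  assumes "rvc_invariant x D r" "y = x \<or> north_step T A x y"
    "Q \<in> terrain_polygons T - D" "y \<in> poly_boundary Q"
  shows "\<exists>s'. rvc_round T A (x, D, r) s'"
proof -
  have Q: "is_polygon Q" using assms(3) terrain_polygonD by blast
  have "y \<in> north_ray A"
    using assms(1,2) north_step_ray(1) by (auto simp: rvc_invariant_def)
  then obtain u where u: "is_farthest (start A) (closed_polygon Q \<inter> north_ray A) u"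
    using farthest_exists[OF Q] assms(4) by (auto simp: closed_polygon_eq)
  obtain ps where "boundary_tour Q y ps"
    using boundary_tour_exists[OF polygon_nonempty[OF Q] assms(4)] by blast
  moreover obtain qs where "boundary_path Q y u qs"
    using boundary_path_exists[OF polygon_nonempty[OF Q] assms(4) farthest_in_boundary[OF Q u]] by blast
  ultimately show ?thesis
    using rvc_round.intros[OF assms(2-4) _ u] by blast
qed

text \<open>Passing to the extremal points keeps a set nonempty and compact, so both selections
  succeed. The point is on the boundary because inside the polygon a small move to the North would
  be possible.\<close>

lemma final_point_exists:
  "\<exists>w \<in> poly_boundary (outer T).
     w \<in> extremal_in (east A) (extremal_in (north A) (closed_polygon (outer T)))"
proof -
  let ?P = "closed_polygon (outer T)"
  have o: "is_polygon (outer T)" using terrain by (simp add: is_terrain_def)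
  have extr: "compact (extremal_in d S) \<and> extremal_in d S \<noteq> {}"
    if S: "compact S" "S \<noteq> {}" for d S
  proof -
    have "continuous_on S (\<lambda>q. q \<bullet> d)" by (intro continuous_intros)
    then obtain p where p: "p \<in> S" "\<And>q. q \<in> S \<Longrightarrow> q \<bullet> d \<le> p \<bullet> d"
      using continuous_attains_sup[OF S] by blast
    \<comment> \<open>Extremal points are those reaching the level of the maximiser
      \<open>p\<close>, which is a closed condition.\<close>
    then have "extremal_in d S = S \<inter> {q. q \<bullet> d \<ge> p \<bullet> d}"
      by (auto simp: extremal_in_def intro: order_trans)
    moreover have "closed {q. q \<bullet> d \<ge> p \<bullet> d}"
      by (intro closed_Collect_le continuous_intros)
    ultimately show ?thesis
      using p S by (auto intro: compact_Int_closed)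
  qed
  have "?P \<noteq> {}" using polygon_Jordan(2)[OF o] by (simp add: closed_polygon_eq)
  then have "extremal_in (east A) (extremal_in (north A) ?P) \<noteq> {}"
    using extr[OF compact_closed_polygon[OF o]] extr[of "extremal_in (north A) ?P"] by simp
  then obtain w where w: "w \<in> extremal_in (east A) (extremal_in (north A) ?P)"
    by blast
  then have max: "w \<in> ?P" "\<And>q. q \<in> ?P \<Longrightarrow> q \<bullet> north A \<le> w \<bullet> north A"
    by (auto simp: extremal_in_def)
  have "w \<notin> open_polygon (outer T)"
  proof
    assume "w \<in> open_polygon (outer T)"
    then obtain e where e: "e > 0" "cball w e \<subseteq> open_polygon (outer T)"
      using polygon_Jordan(1)[OF o] open_contains_cball by blast
    let ?q = "w + e *\<^sub>R north A"
    have "?q \<in> cball w e" using e(1) norm_north by (simp add: dist_norm)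
    then have "?q \<bullet> north A \<le> w \<bullet> north A"
      using e max(2) by (auto simp: closed_polygon_eq)
    then show False
      using e(1) norm_north by (simp add: inner_add_left dot_square_norm)
  qed
  then show ?thesis using w max(1) by (auto simp: closed_polygon_eq)
qed

text \<open>An untraversed polygon at \<open>x\<close> is hit at distance zero. Otherwise a
  northward step, if there is one, ends on a polygon that is not in \<open>D\<close>, since the ray
  beyond \<open>x\<close> avoids those. If there is no step, \<open>x\<close> must be on the outer
  boundary, from where the final path exists.\<close>

lemma rvc_progress:
  assumes inv: "rvc_invariant x D r"
  shows "(\<exists>s'. rvc_round T A (x, D, r) s') \<or> (\<exists>r'. rvc_finish T A (x, D, r) r')"
proof (cases "\<exists>Q. Q \<in> terrain_polygons T - D \<and> x \<in> poly_boundary Q")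
  case True
  then show ?thesis using rvc_round_exists[OF inv] by blast
next
  case new: False
  have beyond: "x + of_real s * north A \<notin> closed_polygon Q" if "Q \<in> D" "s > 0" for Q s
  proof
    assume "x + of_real s * north A \<in> closed_polygon Q"
    then have "dist (start A) (x + of_real s * north A) \<le> dist (start A) x"
      using inv that north_ray_step(1)[of x s] by (auto simp: rvc_invariant_def)
    then show False
      using inv that north_ray_step(2)[of x s] by (auto simp: rvc_invariant_def)
  qed
  show ?thesis
  proof (cases "\<exists>y. north_step T A x y")
    case True
    then obtain y s where y: "north_step T A x y" "s > 0" "y = x + of_real s * north A"
      by (auto simp: north_step_def)
    obtain Q where Q: "Q \<in> terrain_polygons T" "y \<in> poly_boundary Q"
      using frontier_terrain[of y] y(1) by (auto simp: north_step_def)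
    have "Q \<notin> D" using beyond[of Q s] y(2,3) Q(2) by (auto simp: closed_polygon_eq)
    then show ?thesis using rvc_round_exists[OF inv] y(1) Q by blast
  next
    case stuck: False
    have xT: "x \<in> terrain_set T" using inv by (simp add: rvc_invariant_def)
    have "x \<in> poly_boundary (outer T)"
    proof (rule ccontr)
      assume "x \<notin> poly_boundary (outer T)"
      then have xo: "x \<in> open_polygon (outer T)"
        using xT terrain_subset_outer by (auto simp: closed_polygon_eq)
      have "\<exists>y. north_step T A x y"
      proof (rule north_step_exists[OF xo])
        fix Q s assume Q: "Q \<in> set (obstacles T)" "x \<in> closed_polygon Q" "s > (0 :: real)"
        \<comment> \<open>A terrain point lies in no open obstacle, so \<open>Q\<close> touches
          \<open>x\<close> with its boundary; by \<open>new\<close> it has been traversed, and the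
          ray leaves it at \<open>x\<close>.\<close>
        then have "x \<in> poly_boundary Q"
          using xT by (auto simp: terrain_set_def closed_polygon_eq)
        then have "Q \<in> D" using new Q(1) by (auto simp: terrain_polygons_def)
        then show "x + of_real s * north A \<notin> closed_polygon Q" using beyond Q(3) by blast
      qed
      then show False using stuck by blast
    qed
    moreover obtain w where w: "w \<in> poly_boundary (outer T)"
      "w \<in> extremal_in (east A) (extremal_in (north A) (closed_polygon (outer T)))"
      using final_point_exists by blast
    ultimately obtain ps where "boundary_path (outer T) x w ps"
      using boundary_path_exists polygon_nonempty[OF terrain_polygonD[OF outer_in_terrain_polygons]]
      by meson
    then show ?thesis
      using rvc_finish.intros[OF stuck new w(2)] by blast
  qed
qed

lemma rvc_terminates: "rvc_terminates T A"
  unfolding rvc_terminates_def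
proof (intro conjI allI impI notI)
  fix s assume "(rvc_round T A)\<^sup>*\<^sup>* (rvc_init A) s"
  then show "(\<exists>s'. rvc_round T A s s') \<or> (\<exists>r. rvc_finish T A s r)"
    using rvc_progress[OF rvc_invariant_reachable] by (cases s) blast
next
  assume "\<exists>S. S 0 = rvc_init A \<and> (\<forall>n. rvc_round T A (S n) (S (Suc n)))"
  then obtain S where S: "S 0 = rvc_init A" "\<And>n. rvc_round T A (S n) (S (Suc n))"
    by blast
  let ?D = "\<lambda>n. fst (snd (S n))"
  \<comment> \<open>Each round adds a new polygon, so after \<open>n\<close> rounds exactly
    \<open>n\<close> are traversed; one round more than there are polygons is a
    contradiction.\<close>
  have *: "?D n \<subseteq> terrain_polygons T \<and> card (?D n) = n" for n
  proof (induction n)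
    case 0
    then show ?case by (simp add: S(1) rvc_init_def)
  next
    case (Suc n)
    then have "finite (?D n)"
      using finite_terrain_polygons finite_subset by blast
    from S(2)[of n] show ?case
      by cases (use Suc \<open>finite (?D n)\<close> in auto)
  qed
  let ?N = "card (terrain_polygons T)"
  have "card (?D (Suc ?N)) \<le> ?N"
    using * by (intro card_mono finite_terrain_polygons) blast
  then show False using * by (metis Suc_n_not_le_n)
qed

section \<open>Length and endpoint of the routes\<close>

text \<open>Sets forget repetitions, whereas \<open>perimeter\<close> sums over a list; as
  perimeters are nonnegative, the sum over a set can only be smaller.\<close>

lemma sum_poly_perimeter_le:
  assumes "D \<subseteq> terrain_polygons T"
  shows "(\<Sum>Q \<in> D. poly_perimeter Q) \<le> perimeter T"
proof -
  have insert: "(\<Sum>Q \<in> insert q S. poly_perimeter Q) \<le> poly_perimeter q + (\<Sum>Q \<in> S. poly_perimeter Q)"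
    if "finite S" for q S
    using that poly_perimeter_nonneg[of q] by (cases "q \<in> S") (auto simp: insert_absorb)
  have list: "(\<Sum>Q \<in> set qs. poly_perimeter Q) \<le> (\<Sum>Q \<leftarrow> qs. poly_perimeter Q)" for qs
  proof (induction qs)
    case (Cons q qs)
    then show ?case using insert[of "set qs" q] by simp
  qed simp
  have "(\<Sum>Q \<in> D. poly_perimeter Q) \<le> (\<Sum>Q \<in> terrain_polygons T. poly_perimeter Q)"
    using assms by (intro sum_mono2 finite_terrain_polygons poly_perimeter_nonneg) auto
  also have "\<dots> \<le> perimeter T"
    using insert[of "set (obstacles T)" "outer T"] list[of "obstacles T"]
    by (simp add: terrain_polygons_def perimeter_def)
  finally show ?thesis .
qed

lemma rvc_route_final:
  assumes "rvc_route T A r"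
  shows "last r \<in> extremal_in (east A) (extremal_in (north A) (closed_polygon (outer T)))"
    and "route_length r \<le> 4 * perimeter T"
proof -
  obtain x D r0 where reach: "(rvc_round T A)\<^sup>*\<^sup>* (rvc_init A) (x, D, r0)"
      and fin: "rvc_finish T A (x, D, r0) r"
    using assms unfolding rvc_route_def by (metis prod_cases3)
  have inv: "rvc_invariant x D r0" by (rule rvc_invariant_reachable[OF reach])
  have o: "is_polygon (outer T)" using terrain by (simp add: is_terrain_def)
  obtain w ps where w: "w \<in> extremal_in (east A) (extremal_in (north A) (closed_polygon (outer T)))"
      and path: "boundary_path (outer T) x w ps" and r: "r = r0 @ ps"
    using fin by cases auto
  note ends = boundary_path_ends[OF path]
  show "last r \<in> extremal_in (east A) (extremal_in (north A) (closed_polygon (outer T)))"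
    using w ends r by simp
  have outer_le: "poly_perimeter (outer T) \<le> perimeter T"
    using sum_poly_perimeter_le[of "{outer T}"] outer_in_terrain_polygons by simp
  \<comment> \<open>With \<open>x\<close> on the outer boundary, the ball around it whose radius is
    the outer perimeter contains the start, which bounds the distance gained on the ray.\<close>
  have "x \<in> poly_boundary (outer T)"
    by (rule boundary_path_start[OF polygon_nonempty[OF o] path])
  then have "dist (start A) x \<le> poly_perimeter (outer T)"
    using closed_polygon_subset_cball[OF o] agent terrain_subset_outer
    by (force simp: is_agent_def dist_commute)
  moreover have "route_length r = route_length r0 + route_length ps"
    using r inv ends by (simp add: route_length_append rvc_invariant_def)
  moreover have "route_length r0 \<le> dist (start A) x + 2 * perimeter T"
    using inv sum_poly_perimeter_le[of D] by (simp add: rvc_invariant_def)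
  moreover have "route_length ps \<le> perimeter T"
    using boundary_path_length[OF polygon_nonempty[OF o] path] outer_le by linarith
  \<comment> \<open>One perimeter for the distance on the ray, two for the rounds, one for the final
    path.\<close>
  ultimately show "route_length r \<le> 4 * perimeter T"
    using outer_le by linarith
qed

end

section \<open>Meeting at the common final point\<close>

text \<open>The two points have equal components along \<open>d\<close> and along its clockwise
  normal. Up to sign these components of \<open>z\<close> are the real and imaginary parts of
  \<open>z * cnj d\<close>, and \<open>d\<close> is nonzero.\<close>

lemma extremal_point_unique:
  assumes "norm d = 1" "w \<in> extremal_in (- \<i> * d) (extremal_in d S)"
    "w' \<in> extremal_in (- \<i> * d) (extremal_in d S)"
  shows "w = w'"
proof -
  have n: "(w - w') \<bullet> d = 0" and e: "(w - w') \<bullet> (- \<i> * d) = 0"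
    using assms(2,3) by (auto simp: extremal_in_def inner_diff_left intro: antisym)
  define z where "z = w - w'"
  have "Re (z * cnj d) = 0" "Im (z * cnj d) = 0"
    using n e by (simp_all add: z_def inner_complex_def algebra_simps)
  then have "z * cnj d = 0" by (simp add: complex_eq_iff)
  then show ?thesis using assms(1) by (auto simp: z_def)
qed

theorem theorem3p1:
  "\<exists>C :: real. \<forall>(T :: terrain) (A :: agent) (B :: agent).
     is_terrain T \<and> is_agent T A \<and> is_agent T B \<and> start A \<noteq> start B \<and> coherent A B \<longrightarrow>
       rvc_terminates T A \<and> rvc_terminates T B \<and>
       (\<forall>rA rB tA tB fA fB.
          rvc_route T A rA \<and> rvc_route T B rB \<and> is_walk rA tA fA \<and> is_walk rB tB fB \<longrightarrow>
          (\<exists>t. rendezvous_at fA fB t \<and>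
               trajectory_length rA tA fA t + trajectory_length rB tB fB t \<le> C * perimeter T))"
proof (rule exI[of _ 8], intro allI impI conjI; elim conjE)
  fix T A B
  assume asm: "is_terrain T" "is_agent T A" "is_agent T B" "coherent A B"
  show "rvc_terminates T A" "rvc_terminates T B"
    using rvc_terminates asm by blast+
  fix rA rB tA tB fA fB
  assume r: "rvc_route T A rA" "rvc_route T B rB"
    and w: "is_walk rA tA fA" "is_walk rB tB fB"
  \<comment> \<open>A common North gives a common East, so both final points are extremal for the
    same pair of directions in the same polygon.\<close>
  have "east A = - \<i> * north A" "east B = - \<i> * north A" "north B = north A"
    using asm(4) by (simp_all add: east_def coherent_def)
  then have last: "last rA = last rB"
    using rvc_route_final(1)[OF asm(1,2) r(1)] rvc_route_final(1)[OF asm(1,3) r(2)]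
      extremal_point_unique[of "north A"] asm(2) by (metis is_agent_def)
  \<comment> \<open>At \<open>t0\<close> both agents are inert at the ends of their routes; the
    entry 0 makes \<open>t0\<close> an admissible time.\<close>
  define t0 where "t0 = Max {0, last tA, last tB}"
  have "fA t0 = last rA" "fB t0 = last rB" "t0 \<ge> 0"
    using w by (auto simp: is_walk_def t0_def)
  then obtain t where t: "rendezvous_at fA fB t"
    using rendezvous_exists[OF walk_continuous[OF w(1)] walk_continuous[OF w(2)]] last by metis
  \<comment> \<open>Each trajectory is at most its whole route, hence at most 4 perimeters; two
    agents give the constant 8.\<close>
  have "trajectory_length rA tA fA t + trajectory_length rB tB fB t \<le> 8 * perimeter T"
    using trajectory_length_le[OF w(1), of t] trajectory_length_le[OF w(2), of t]
      rvc_route_final(2)[OF asm(1,2) r(1)] rvc_route_final(2)[OF asm(1,3) r(2)] by linarith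
  with t show "\<exists>t. rendezvous_at fA fB t \<and>
      trajectory_length rA tA fA t + trajectory_length rB tB fB t \<le> 8 * perimeter T" by blast
qed

end
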